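(* Let $T>0$ and let $f\in C^1([0,T])$ be real-valued (so $f'(t)$ exists and is continuous for $t\in[0,T]$). (a) If $f$ attains its maximum value over $[0,T]$ at a point $t_0\in[0,T]$, then for every $0<\alpha<1$ $$\left(D_*^{\alpha}f\right)(t_0)\ \ge\ \frac{1}{1-\alpha}\,E_{\alpha,1}\!\left[-\alpha\frac{t_0^{\alpha}}{1-\alpha}\right]\bigl(f(t_0)-f(0)\bigr)\ \ge\ 0.$$ (b) If $f$ attains its minimum value over $[0,T]$ at a point $t_0\in[0,T]$, then for every $0<\alpha<1$ $$\left(D_*^{\alpha}f\right)(t_0)\ \le\ \frac{1}{1-\alpha}\,E_{\alpha,1}\!\left[-\alpha\frac{t_0^{\alpha}}{1-\alpha}\right]\bigl(f(t_0)-f(0)\bigr)\ \le\ 0.$$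
   Context: The Mittag-Leffler function is $E_{\alpha,\beta}(z)=\sum_{k=0}^{\infty}\frac{z^k}{\Gamma(\alpha k+\beta)}$. For $0<\alpha<1$, the Atangana-Baleanu fractional derivative of order $\alpha$ (with normalization function taken identically equal to $1$ and lower limit $0$) is $$D_*^{\alpha}f(t)=\frac{1}{1-\alpha}\int_0^t f'(s)\,E_{\alpha,1}\!\left[-\alpha\frac{(t-s)^{\alpha}}{1-\alpha}\right]ds .$$ *)

theory Defs
  imports "HOL-Analysis.Analysis"
begin

text \<open>At the poles of the Gamma function the library value is \<^term>\<open>0::real\<close>, so division by it
  agrees with the usual convention that the reciprocal Gamma function vanishes there.\<close>

definition mittag_leffler :: "real \<Rightarrow> real \<Rightarrow> real \<Rightarrow> real" where
  "mittag_leffler \<alpha> \<beta> z = (\<Sum>k. z ^ k / Gamma (\<alpha> * real k + \<beta>))"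

text \<open>The Atangana-Baleanu derivative with normalization function 1 and lower limit 0.
  The derivative of \<open>f\<close> is taken relative to the interval of integration, hence one-sided at
  the end points, so the value depends only on the restriction of \<open>f\<close> to that interval.\<close>

definition AB_derivative :: "real \<Rightarrow> (real \<Rightarrow> real) \<Rightarrow> real \<Rightarrow> real" where
  "AB_derivative \<alpha> f t =
     1 / (1 - \<alpha>) *
     integral {0..t} (\<lambda>s. vector_derivative f (at s within {0..t}) *
       mittag_leffler \<alpha> 1 (- \<alpha> * ((t - s) powr \<alpha> / (1 - \<alpha>))))"

end

theory Submission
  imports Defs
begin

text \<open>
  Write \<open>E\<close> for the Mittag-Leffler function with parameters \<open>\<alpha>\<close> and \<open>1\<close>, where \<open>0 < \<alpha> < 1\<close>.
  Everything rests on one analytic fact: on the negative half-line \<open>E\<close> is nonnegative and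
  increasing (\<open>mittag_leffler_nonneg_mono\<close>). Granting it, the kernel
  \<open>K(s) = E(-\<alpha> (t - s)^\<alpha> / (1 - \<alpha>))\<close> increases from \<open>K(0) \<ge> 0\<close> to \<open>K(t) = 1\<close> on \<open>[0, t]\<close>, and the
  second mean value theorem for integrals yields a point \<open>c\<close> in \<open>[0, t]\<close> with
  \<open>\<integral>\<^sub>0\<^sup>t K f' = K(0) (f(c) - f(0)) + (f(t) - f(c))\<close>. This differs from \<open>K(0) (f(t) - f(0))\<close> by
  \<open>(1 - K(0)) (f(t) - f(c))\<close>, whose sign is known when \<open>t\<close> is an extremal point of \<open>f\<close>. Using
  the mean value theorem instead of integration by parts makes it unnecessary to
  differentiate \<open>K\<close>, whose derivative may be unbounded near \<open>s = t\<close>.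

  The sign and monotonicity of \<open>E\<close> are invisible in its alternating series. They are obtained
  by deforming \<open>exp (- x)\<close> into \<open>E(-x)\<close> through operations that visibly preserve both
  properties. Multiplying the \<open>k\<close>-th Taylor coefficient of a function \<open>\<phi>\<close> by
  \<open>(\<alpha> k + j) / (k + j) = \<alpha> + (1 - \<alpha>) j / (k + j)\<close> replaces \<open>\<phi>(x)\<close> by
  \<open>\<alpha> \<phi>(x) + (1 - \<alpha>) \<integral>\<^sub>0\<^sup>1 \<phi>(x u) j u^(j-1) du\<close>, an average of values of \<open>\<phi>\<close> at points \<open>x u\<close>; so a
  nonnegative decreasing \<open>\<phi>\<close> stays nonnegative and decreasing
  (\<open>ml_approx_nonneg_antimono\<close>). Applying this for \<open>j = 1, ..., n\<close> to the exponential and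
  rescaling the variable by \<open>n^(1-\<alpha>)\<close> produces the coefficients
  \<open>n^((1-\<alpha>)k) \<Prod>\<^sub>j (\<alpha> k + j) / (k + j) / k!\<close> up to sign. By the product formula of Gauss for the Gamma function
  they tend to \<open>1 / \<Gamma>(\<alpha> k + 1)\<close>, and they do so increasingly, so the limiting series dominates
  and Tannery's theorem applies (\<open>ml_approx_tendsto\<close>).

  In probabilistic terms, \<open>k! / \<Gamma>(\<alpha> k + 1)\<close> is the \<open>k\<close>-th moment of a rescaled infinite product of
  independent random variables, each equal to \<open>1\<close> with probability \<open>\<alpha>\<close> and otherwise
  Beta distributed, and \<open>E(-x)\<close> is the Laplace transform of that product.
\<close>

section \<open>Averages of power series\<close>

lemma summable_power_series_average:
  fixes c :: "nat \<Rightarrow> real" and y :: real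
  assumes summable_c: "\<And>y. summable (\<lambda>k. c k * y ^ k)"
  shows "summable (\<lambda>k. c k * (real (Suc m) / (real k + real (Suc m))) * y ^ k)"
proof (rule summable_comparison_test')
  show "summable (\<lambda>k. norm (c k * y ^ k))"
    using powser_insidea[OF summable_c[of "\<bar>y\<bar> + 1"], of y] by simp
  fix k :: nat
  define w where "w = real (Suc m) / (real k + real (Suc m))"
  have "\<bar>w\<bar> \<le> 1" by (simp add: w_def)
  then have "\<bar>c k * y ^ k\<bar> * \<bar>w\<bar> \<le> \<bar>c k * y ^ k\<bar> * 1"
    by (rule mult_left_mono) simp
  then show "norm (c k * w * y ^ k) \<le> norm (c k * y ^ k)"
    by (simp add: abs_mult mult_ac)
qed

text \<open>
  Term by term this is \<open>\<integral>\<^sub>0\<^sup>1 u^k j u^(j-1) du = j / (k + j)\<close> with \<open>j = m + 1\<close>. To avoid exchanging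
  sum and integral, the right-hand series \<open>\<Psi>\<close> is recognised as a solution of the Euler
  equation \<open>y \<Psi>'(y) + j \<Psi>(y) = j \<Phi>(y)\<close>, where \<open>\<Phi>\<close> is the given series; hence \<open>u^j \<Psi>(x u)\<close> is an
  antiderivative of the integrand.
\<close>

lemma has_integral_power_series_average:
  fixes c :: "nat \<Rightarrow> real" and x :: real
  assumes summable_c: "\<And>y. summable (\<lambda>k. c k * y ^ k)"
  shows "((\<lambda>u. (\<Sum>k. c k * (x * u) ^ k) * (real (Suc m) * u ^ m)) has_integral
           (\<Sum>k. c k * (real (Suc m) / (real k + real (Suc m))) * x ^ k)) {0..1}"
proof -
  define j where "j = real (Suc m)"
  define d where "d = (\<lambda>k. c k * (j / (real k + j)))"
  define \<Psi> where "\<Psi> = (\<lambda>y. \<Sum>k. d k * y ^ k)"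
  have j: "j > 0" unfolding j_def by simp
  have summable_d: "summable (\<lambda>k. d k * y ^ k)" for y
    unfolding d_def j_def by (rule summable_power_series_average[OF summable_c])
  have euler: "y * (\<Sum>k. diffs d k * y ^ k) + j * \<Psi> y = j * (\<Sum>k. c k * y ^ k)" for y
  proof -
    have "(\<lambda>k. real k * d k * y ^ (k - Suc 0)) sums (\<Sum>k. diffs d k * y ^ k)"
      using diffs_equiv[OF termdiff_converges_all[OF summable_d]] by simp
    then have "(\<lambda>k. y * (real k * d k * y ^ (k - Suc 0)) + j * (d k * y ^ k)) sums
        (y * (\<Sum>k. diffs d k * y ^ k) + j * \<Psi> y)"
      unfolding \<Psi>_def by (intro sums_add sums_mult summable_sums summable_d)
    moreover have "y * (real k * d k * y ^ (k - Suc 0)) + j * (d k * y ^ k)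
        = j * (c k * y ^ k)" for k
    proof -
      have "y * (real k * d k * y ^ (k - Suc 0)) = real k * d k * y ^ k"
        by (cases k) auto
      moreover have "(real k + j) * d k = j * c k"
        using j by (simp add: d_def)
      ultimately show ?thesis
        by (metis (no_types, lifting) distrib_right mult.assoc)
    qed
    ultimately have "(\<lambda>k. j * (c k * y ^ k)) sums (y * (\<Sum>k. diffs d k * y ^ k) + j * \<Psi> y)"
      by simp
    moreover have "(\<lambda>k. j * (c k * y ^ k)) sums (j * (\<Sum>k. c k * y ^ k))"
      by (intro sums_mult summable_sums summable_c)
    ultimately show ?thesis by (rule sums_unique2)
  qed
  have "((\<lambda>u. (\<Sum>k. c k * (x * u) ^ k) * (j * u ^ m)) has_integral
      (1 ^ Suc m * \<Psi> (x * 1) - 0 ^ Suc m * \<Psi> (x * 0))) {0..1}"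
  proof (rule fundamental_theorem_of_calculus)
    fix u :: real
    have \<Psi>': "(\<Psi> has_real_derivative (\<Sum>k. diffs d k * (x * u) ^ k)) (at (x * u))"
      unfolding \<Psi>_def by (rule termdiffs_strong_converges_everywhere[OF summable_d])
    have "((\<lambda>u. u ^ Suc m * \<Psi> (x * u)) has_real_derivative
        (j * u ^ m) * \<Psi> (x * u) + u ^ Suc m * ((\<Sum>k. diffs d k * (x * u) ^ k) * x)) (at u)"
    proof -
      have "((\<lambda>u. \<Psi> (x * u)) has_real_derivative (\<Sum>k. diffs d k * (x * u) ^ k) * x) (at u)"
        by (rule DERIV_chain2[where f = \<Psi> and g = "\<lambda>u. x * u", OF \<Psi>']) (auto intro!: derivative_eq_intros)
      then show ?thesis
        by (auto intro!: derivative_eq_intros simp: j_def simp del: power_Suc)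
    qed
    also have "(j * u ^ m) * \<Psi> (x * u) + u ^ Suc m * ((\<Sum>k. diffs d k * (x * u) ^ k) * x)
        = u ^ m * ((x * u) * (\<Sum>k. diffs d k * (x * u) ^ k) + j * \<Psi> (x * u))"
      by (simp add: algebra_simps)
    also have "\<dots> = (\<Sum>k. c k * (x * u) ^ k) * (j * u ^ m)"
      by (simp add: euler)
    finally show "((\<lambda>u. u ^ Suc m * \<Psi> (x * u)) has_vector_derivative
        (\<Sum>k. c k * (x * u) ^ k) * (j * u ^ m)) (at u within {0..1})"
      by (simp add: has_real_derivative_iff_has_vector_derivative has_vector_derivative_at_within)
  qed simp
  then show ?thesis
    by (simp add: \<Psi>_def d_def j_def)
qed

section \<open>Interpolating between the exponential and the Mittag-Leffler function\<close>

definition ml_weight :: "real \<Rightarrow> nat \<Rightarrow> nat \<Rightarrow> real" where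
  "ml_weight \<alpha> n k = (\<Prod>j=1..n. (\<alpha> * real k + real j) / (real k + real j))"

definition ml_approx :: "real \<Rightarrow> nat \<Rightarrow> real \<Rightarrow> real" where
  "ml_approx \<alpha> n x = (\<Sum>k. ml_weight \<alpha> n k * ((- 1) ^ k / fact k) * x ^ k)"

lemma ml_weight_Suc:
  "ml_weight \<alpha> (Suc n) k =
    ml_weight \<alpha> n k * ((\<alpha> * real k + real (Suc n)) / (real k + real (Suc n)))"
  by (simp add: ml_weight_def)

lemma ml_weight_bounds:
  assumes "0 \<le> \<alpha>" "\<alpha> \<le> 1"
  shows "0 \<le> ml_weight \<alpha> n k" "ml_weight \<alpha> n k \<le> 1"
proof -
  have "\<alpha> * real k \<le> real k" using assms by (simp add: mult_left_le_one_le)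
  then show "0 \<le> ml_weight \<alpha> n k" "ml_weight \<alpha> n k \<le> 1"
    unfolding ml_weight_def using assms
    by (auto intro!: prod_nonneg prod_le_1 divide_nonneg_nonneg add_nonneg_nonneg
        simp: divide_le_eq_1)
qed

lemma summable_ml_approx:
  assumes "0 \<le> \<alpha>" "\<alpha> \<le> 1"
  shows "summable (\<lambda>k. ml_weight \<alpha> n k * ((- 1) ^ k / fact k) * x ^ k)"
proof (rule summable_comparison_test')
  show "summable (\<lambda>k. \<bar>x\<bar> ^ k / fact k)"
    using summable_exp[of "\<bar>x\<bar>"] by (simp add: field_simps)
  fix k
  show "norm (ml_weight \<alpha> n k * ((- 1) ^ k / fact k) * x ^ k) \<le> \<bar>x\<bar> ^ k / fact k"
    using ml_weight_bounds[OF assms, of n k]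
    by (simp add: abs_mult power_abs mult_left_le_one_le divide_right_mono)
qed

lemma ml_approx_0: "ml_approx \<alpha> 0 x = exp (- x)"
proof -
  have "(- 1) ^ k / fact k * x ^ k = (- x) ^ k /\<^sub>R fact k" for k
    by (subst (2) power_minus) (simp add: field_simps)
  then show ?thesis
    by (simp add: ml_approx_def ml_weight_def exp_def)
qed

text \<open>
  The decomposition \<open>(\<alpha> k + j) / (k + j) = \<alpha> + (1 - \<alpha>) j / (k + j)\<close> of the new factor turns
  multiplication of coefficients into a mixture of the identity and the average of
  \<open>has_integral_power_series_average\<close>, at \<open>j = n + 1\<close>.
\<close>

lemma ml_approx_Suc:
  assumes \<alpha>: "0 \<le> \<alpha>" "\<alpha> \<le> 1"
  shows "((\<lambda>u. ml_approx \<alpha> n (x * u) * (real (Suc n) * u ^ n)) has_integral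
           (\<Sum>k. ml_weight \<alpha> n k * ((- 1) ^ k / fact k) *
              (real (Suc n) / (real k + real (Suc n))) * x ^ k)) {0..1}" (is "(?g has_integral ?S) _")
    and "ml_approx \<alpha> (Suc n) x = \<alpha> * ml_approx \<alpha> n x +
      (1 - \<alpha>) * integral {0..1} (\<lambda>u. ml_approx \<alpha> n (x * u) * (real (Suc n) * u ^ n))"
proof -
  show int: "(?g has_integral ?S) {0..1}"
    unfolding ml_approx_def
    by (rule has_integral_power_series_average[OF summable_ml_approx[OF \<alpha>]])
  define a where "a = (\<lambda>k. ml_weight \<alpha> n k * ((- 1) ^ k / fact k) * x ^ k)"
  have a: "summable a" unfolding a_def by (rule summable_ml_approx[OF \<alpha>])
  have fac: "(\<alpha> * real k + real (Suc n)) / (real k + real (Suc n))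
      = \<alpha> + (1 - \<alpha>) * (real (Suc n) / (real k + real (Suc n)))" for k
    by (simp add: field_simps)
  have S: "summable (\<lambda>k. a k * (real (Suc n) / (real k + real (Suc n))))"
    using summable_power_series_average[OF summable_ml_approx[OF \<alpha>], where y = x and m = n]
    unfolding a_def by (simp only: mult_ac)
  have "ml_approx \<alpha> (Suc n) x
      = (\<Sum>k. \<alpha> * a k + (1 - \<alpha>) * (a k * (real (Suc n) / (real k + real (Suc n)))))"
    unfolding ml_approx_def ml_weight_Suc fac a_def
    by (rule suminf_cong) (simp only: ring_distribs mult_ac)
  also have "\<dots> = \<alpha> * (\<Sum>k. a k)
      + (1 - \<alpha>) * (\<Sum>k. a k * (real (Suc n) / (real k + real (Suc n))))"
    by (simp only: suminf_add[symmetric] suminf_mult summable_mult a S)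
  also have "(\<Sum>k. a k) = ml_approx \<alpha> n x"
    by (simp add: a_def ml_approx_def)
  also have "(\<Sum>k. a k * (real (Suc n) / (real k + real (Suc n)))) = integral {0..1} ?g"
    unfolding integral_unique[OF int] a_def by (rule suminf_cong) (simp add: mult_ac)
  finally show "ml_approx \<alpha> (Suc n) x = \<alpha> * ml_approx \<alpha> n x + (1 - \<alpha>) * integral {0..1} ?g" .
qed

text \<open>
  The exponential has both properties, and the recurrence only averages values at
  points \<open>x u\<close> with nonnegative weights that do not depend on \<open>x\<close>.
\<close>

lemma ml_approx_nonneg_antimono:
  assumes \<alpha>: "0 \<le> \<alpha>" "\<alpha> \<le> 1" and "0 \<le> x" "x \<le> y"
  shows "0 \<le> ml_approx \<alpha> n y \<and> ml_approx \<alpha> n y \<le> ml_approx \<alpha> n x"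
  using assms(3,4)
proof (induction n arbitrary: x y)
  case 0
  then show ?case by (simp add: ml_approx_0)
next
  case (Suc n)
  define I where "I = (\<lambda>x. integral {0..1} (\<lambda>u. ml_approx \<alpha> n (x * u) * (real (Suc n) * u ^ n)))"
  have rec: "ml_approx \<alpha> (Suc n) z = \<alpha> * ml_approx \<alpha> n z + (1 - \<alpha>) * I z" for z
    unfolding I_def by (rule ml_approx_Suc(2)[OF \<alpha>])
  have integrable: "(\<lambda>u. ml_approx \<alpha> n (z * u) * (real (Suc n) * u ^ n)) integrable_on {0..1}" for z
    using ml_approx_Suc(1)[OF \<alpha>] by (rule has_integral_integrable)
  have IH: "0 \<le> ml_approx \<alpha> n (y * u) \<and> ml_approx \<alpha> n (y * u) \<le> ml_approx \<alpha> n (x * u)"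
    if "0 \<le> u" for u
    by (rule Suc.IH) (use that Suc.prems in \<open>auto intro: mult_right_mono\<close>)
  have "0 \<le> I y"
    unfolding I_def
    by (rule integral_nonneg[OF integrable]) (simp add: IH)
  moreover have "I y \<le> I x"
    unfolding I_def
    by (rule integral_le[OF integrable integrable]) (rule mult_right_mono, simp_all add: IH)
  ultimately show ?case
    unfolding rec using Suc.IH[OF Suc.prems] \<alpha> by (auto intro!: add_mono mult_left_mono)
qed

section \<open>Passage to the limit\<close>

text \<open>
  With Pochhammer symbols the weight is \<open>(\<alpha> k + 1)\<^sub>n / (k + 1)\<^sub>n\<close>, so up to the power of \<open>n\<close> it is the
  quotient of the products of Gauss that converge to \<open>\<Gamma>(k + 1)\<close> and \<open>\<Gamma>(\<alpha> k + 1)\<close>.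
\<close>

lemma ml_weight_tendsto:
  assumes "0 < \<alpha>"
  shows "(\<lambda>n. real n powr ((1 - \<alpha>) * real k) * ml_weight \<alpha> n k) \<longlonglongrightarrow>
    fact k / Gamma (\<alpha> * real k + 1)"
proof -
  have weight: "ml_weight \<alpha> n k
      = pochhammer (\<alpha> * real k + 1) n / pochhammer (real k + 1) n" for n
  proof (induction n)
    case 0
    then show ?case by (simp add: ml_weight_def)
  next
    case (Suc n)
    then show ?case
      by (simp add: ml_weight_Suc pochhammer_Suc mult_ac add_ac)
  qed
  have pos: "\<alpha> * real k + 1 > 0" using assms by (simp add: add_nonneg_pos)
  have "(\<lambda>n. Gamma_series' (real k + 1) n / Gamma_series' (\<alpha> * real k + 1) n)
      \<longlonglongrightarrow> Gamma (real k + 1) / Gamma (\<alpha> * real k + 1)"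
    using Gamma_real_pos[OF pos] by (intro tendsto_divide Gamma_series'_LIMSEQ) simp
  moreover have "\<forall>\<^sub>F n in sequentially.
      Gamma_series' (real k + 1) n / Gamma_series' (\<alpha> * real k + 1) n
      = real n powr ((1 - \<alpha>) * real k) * ml_weight \<alpha> n k"
    using eventually_gt_at_top[of 0]
  proof eventually_elim
    case (elim n)
    have "exp ((real k + 1) * ln (real n)) / exp ((\<alpha> * real k + 1) * ln (real n))
        = real n powr ((1 - \<alpha>) * real k)"
      using elim by (simp add: powr_def exp_diff[symmetric] algebra_simps)
    moreover have "Gamma_series' (real k + 1) n / Gamma_series' (\<alpha> * real k + 1) n
        = exp ((real k + 1) * ln (real n)) / exp ((\<alpha> * real k + 1) * ln (real n)) *
          (pochhammer (\<alpha> * real k + 1) n / pochhammer (real k + 1) n)"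
      by (simp add: Gamma_series'_def)
    ultimately show ?case by (simp add: weight)
  qed
  ultimately have "(\<lambda>n. real n powr ((1 - \<alpha>) * real k) * ml_weight \<alpha> n k) \<longlonglongrightarrow>
      Gamma (real k + 1) / Gamma (\<alpha> * real k + 1)"
    by (rule Lim_transform_eventually)
  then show ?thesis by (simp add: Gamma_fact add.commute)
qed

text \<open>
  The left-hand side increases with \<open>n\<close>, hence stays below its limit. With \<open>m = n + 1\<close> and
  \<open>s = (1 - \<alpha>) k\<close>, the step from \<open>n\<close> to \<open>m\<close> amounts to
  \<open>(k + m) / (\<alpha> k + m) \<le> (m / (m - 1))^s\<close>; the logarithms of the two sides are separated by \<open>s / m\<close>.
\<close>

lemma ml_weight_le:
  assumes "0 < \<alpha>" "\<alpha> \<le> 1" and "0 < n"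
  shows "real n powr ((1 - \<alpha>) * real k) * ml_weight \<alpha> n k \<le> fact k / Gamma (\<alpha> * real k + 1)"
proof -
  define q where "q = (\<lambda>n. real (Suc n) powr ((1 - \<alpha>) * real k) * ml_weight \<alpha> (Suc n) k)"
  \<comment> \<open>the index is shifted because the factor \<open>m / (m - 1)\<close> makes no sense for \<open>m = 1\<close>\<close>
  have "incseq q"
  proof (rule incseq_SucI)
    fix n
    define m where "m = real (Suc (Suc n))"
    define s where "s = (1 - \<alpha>) * real k"
    have m: "m > 1" and s: "s \<ge> 0" using assms by (simp_all add: m_def s_def)
    have ak: "0 \<le> \<alpha> * real k" using assms by simp
    have "ln ((real k + m) / (\<alpha> * real k + m)) = ln (1 + s / (\<alpha> * real k + m))"
      using m ak by (simp add: s_def field_simps)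
    also have "\<dots> \<le> s / (\<alpha> * real k + m)"
      using m ak s by (intro ln_add_one_self_le_self) simp
    also have "\<dots> \<le> s / m"
      using m ak s by (intro divide_left_mono) auto
    also have "\<dots> \<le> s * (- ln (1 - 1 / m))"
    proof -
      have "ln (1 - 1 / m) \<le> - 1 / m"
        using m ln_le_minus_one[of "1 - 1 / m"] by simp
      then have "1 / m \<le> - ln (1 - 1 / m)" by simp
      from mult_left_mono[OF this s] show ?thesis by simp
    qed
    also have "\<dots> = s * (ln m - ln (m - 1))"
    proof -
      have "1 - 1 / m = (m - 1) / m" using m by (simp add: field_simps)
      then show ?thesis using m by (simp add: ln_div)
    qed
    finally have L: "ln ((real k + m) / (\<alpha> * real k + m)) \<le> s * (ln m - ln (m - 1))" .
    have "(real k + m) / (\<alpha> * real k + m) \<le> exp (s * (ln m - ln (m - 1)))"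
    proof -
      have "0 < (real k + m) / (\<alpha> * real k + m)"
        using m ak by (intro divide_pos_pos) auto
      with L show ?thesis by (metis exp_le_cancel_iff exp_ln)
    qed
    also have "\<dots> = m powr s / (m - 1) powr s"
      using m by (simp add: powr_def exp_diff[symmetric] algebra_simps)
    finally have "(m - 1) powr s \<le> m powr s * ((\<alpha> * real k + m) / (real k + m))"
      using m ak by (simp add: field_simps)
    then have "(m - 1) powr s * ml_weight \<alpha> (Suc n) k
        \<le> m powr s * ((\<alpha> * real k + m) / (real k + m)) * ml_weight \<alpha> (Suc n) k"
      using ml_weight_bounds(1)[of \<alpha>] assms by (intro mult_right_mono) auto
    then show "q n \<le> q (Suc n)"
      by (simp add: q_def ml_weight_Suc[of \<alpha> "Suc n"] m_def s_def mult_ac)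
  qed
  moreover have "q \<longlonglongrightarrow> fact k / Gamma (\<alpha> * real k + 1)"
    unfolding q_def using ml_weight_tendsto[OF assms(1)] by (rule LIMSEQ_Suc)
  ultimately have "q (n - 1) \<le> fact k / Gamma (\<alpha> * real k + 1)"
    by (rule incseq_le)
  then show ?thesis using assms(3) by (simp add: q_def)
qed

text \<open>
  Log-convexity of \<open>\<Gamma>\<close> at \<open>x = (1 - a) (y + 1) + a y\<close> with \<open>y = x + a - 1\<close>, combined with
  \<open>\<Gamma>(y + 1) = y \<Gamma>(y)\<close>. It makes the ratios of consecutive Mittag-Leffler coefficients tend to \<open>0\<close>.
\<close>

lemma Gamma_add_ge:
  fixes x a :: real
  assumes "1 < x + a" "0 < x" "0 \<le> a" "a \<le> 1"
  shows "(x + a - 1) powr a * Gamma x \<le> Gamma (x + a)"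
proof -
  define y where "y = x + a - 1"
  have y: "y > 0" using assms by (simp add: y_def)
  note pos = Gamma_real_pos[OF y] Gamma_real_pos[OF assms(2)]
  have "(ln \<circ> Gamma) ((1 - a) *\<^sub>R (y + 1) + a *\<^sub>R y)
      \<le> (1 - a) * (ln \<circ> Gamma) (y + 1) + a * (ln \<circ> Gamma) y"
    using assms y by (intro convex_onD[OF log_convex_Gamma_real]) auto
  moreover have "(1 - a) *\<^sub>R (y + 1) + a *\<^sub>R y = x" by (simp add: y_def algebra_simps)
  moreover have G: "Gamma (y + 1) = y * Gamma y"
    using y by (intro Gamma_plus1) (auto elim!: nonpos_Ints_cases)
  ultimately have "ln (Gamma x) + a * ln y \<le> ln (Gamma (y + 1))"
    using pos y by (simp add: ln_mult_pos algebra_simps)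
  then have "exp (ln (Gamma x) + a * ln y) \<le> exp (ln (Gamma (y + 1)))" by simp
  then show ?thesis
    using pos y by (simp add: exp_add powr_def G y_def mult.commute)
qed

lemma summable_mittag_leffler:
  fixes \<alpha> z :: real
  assumes "0 < \<alpha>" "\<alpha> \<le> 1"
  shows "summable (\<lambda>k. z ^ k / Gamma (\<alpha> * real k + 1))"
proof -
  \<comment> \<open>beyond \<open>N0\<close> the growth factor \<open>(\<alpha> k + \<alpha>)^\<alpha>\<close> of the denominators exceeds \<open>2 |z|\<close>\<close>
  obtain N0 where N0: "(2 * \<bar>z\<bar> + 1) powr (1 / \<alpha>) / \<alpha> < real N0"
    using reals_Archimedean2 by blast
  show ?thesis
  proof (rule summable_ratio_test[of "1 / 2" "Suc N0"])
    fix k assume k: "k \<ge> Suc N0"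
    define x where "x = \<alpha> * real k + 1"
    have "(2 * \<bar>z\<bar> + 1) powr (1 / \<alpha>) \<le> \<alpha> * real N0"
      using N0 assms by (simp add: field_simps)
    also have "\<dots> \<le> \<alpha> * real k" using k assms by simp
    also have "\<dots> \<le> x + \<alpha> - 1" using assms by (simp add: x_def)
    finally have "((2 * \<bar>z\<bar> + 1) powr (1 / \<alpha>)) powr \<alpha> \<le> (x + \<alpha> - 1) powr \<alpha>"
      using assms by (intro powr_mono2) auto
    then have big: "2 * \<bar>z\<bar> \<le> (x + \<alpha> - 1) powr \<alpha>"
      using assms by (simp add: powr_powr)
    have x: "x > 0" using assms by (simp add: x_def add_nonneg_pos)
    have x1: "x + \<alpha> > 1" using assms by (simp add: x_def add_nonneg_pos)
    note pos = Gamma_real_pos[OF x] Gamma_real_pos[of "x + \<alpha>"]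
    have "2 * \<bar>z\<bar> * Gamma x \<le> (x + \<alpha> - 1) powr \<alpha> * Gamma x"
      using big pos by (intro mult_right_mono) auto
    also have "\<dots> \<le> Gamma (x + \<alpha>)"
      using assms x x1 by (intro Gamma_add_ge) auto
    finally have "2 * \<bar>z\<bar> * Gamma x \<le> Gamma (x + \<alpha>)" .
    then have "\<bar>z\<bar> / Gamma (x + \<alpha>) \<le> 1 / 2 * (1 / Gamma x)"
      using pos x1 by (simp add: field_simps)
    from mult_left_mono[OF this, of "\<bar>z\<bar> ^ k"]
    have "\<bar>z\<bar> ^ Suc k / Gamma (x + \<alpha>) \<le> 1 / 2 * (\<bar>z\<bar> ^ k / Gamma x)"
      by (simp add: mult_ac)
    moreover have "\<alpha> * real (Suc k) + 1 = x + \<alpha>" by (simp add: x_def algebra_simps)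
    ultimately show "norm (z ^ Suc k / Gamma (\<alpha> * real (Suc k) + 1))
        \<le> 1 / 2 * norm (z ^ k / Gamma (\<alpha> * real k + 1))"
      using pos x1 by (simp add: x_def[symmetric] abs_mult power_abs del: of_nat_Suc)
  qed simp
qed

lemma ml_approx_tendsto:
  assumes "0 < \<alpha>" "\<alpha> \<le> 1"
  shows "(\<lambda>n. ml_approx \<alpha> n (x * real n powr (1 - \<alpha>))) \<longlonglongrightarrow> mittag_leffler \<alpha> 1 (- x)"
proof -
  define a where "a = (\<lambda>k n. ml_weight \<alpha> n k * ((- 1) ^ k / fact k) * (x * real n powr (1 - \<alpha>)) ^ k)"
  have a: "a k n = (- x) ^ k / fact k * (real n powr ((1 - \<alpha>) * real k) * ml_weight \<alpha> n k)"
    if "n > 0" for k n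
  proof -
    have "(real n powr (1 - \<alpha>)) ^ k = real n powr ((1 - \<alpha>) * real k)"
      using that by (simp add: powr_power mult.commute)
    then show ?thesis
      unfolding a_def by (simp add: power_mult_distrib power_minus[of x])
  qed
  have lim: "(a k \<longlongrightarrow> (- x) ^ k / Gamma (\<alpha> * real k + 1)) sequentially" for k
  proof (rule Lim_transform_eventually)
    show "(\<lambda>n. (- x) ^ k / fact k * (real n powr ((1 - \<alpha>) * real k) * ml_weight \<alpha> n k))
        \<longlonglongrightarrow> (- x) ^ k / Gamma (\<alpha> * real k + 1)"
      using tendsto_mult_left[OF ml_weight_tendsto[OF assms(1), of k], of "(- x) ^ k / fact k"]
      by simp
    show "\<forall>\<^sub>F n in sequentially. (- x) ^ k / fact k *
        (real n powr ((1 - \<alpha>) * real k) * ml_weight \<alpha> n k) = a k n"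
      using eventually_gt_at_top[of 0] by eventually_elim (simp add: a)
  qed
  have bound: "norm (a k n) \<le> \<bar>x\<bar> ^ k / Gamma (\<alpha> * real k + 1)" if "n > 0" for k n
  proof -
    have "norm (a k n) = \<bar>x\<bar> ^ k / fact k * (real n powr ((1 - \<alpha>) * real k) * ml_weight \<alpha> n k)"
      using ml_weight_bounds(1)[of \<alpha>] assms by (simp add: a[OF that] abs_mult power_abs)
    also have "\<dots> \<le> \<bar>x\<bar> ^ k / fact k * (fact k / Gamma (\<alpha> * real k + 1))"
      by (intro mult_left_mono ml_weight_le assms that) simp
    finally show ?thesis by simp
  qed
  have "((\<lambda>n. suminf (\<lambda>k. a k n)) \<longlongrightarrow> (\<Sum>k. (- x) ^ k / Gamma (\<alpha> * real k + 1))) sequentially"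
  proof (rule tannerys_theorem[OF lim _ summable_mittag_leffler[OF assms, of "\<bar>x\<bar>"],
        THEN conjunct2, THEN conjunct2])
    show "\<forall>\<^sub>F (k, n) in at_top \<times>\<^sub>F sequentially.
        norm (a k n) \<le> \<bar>x\<bar> ^ k / Gamma (\<alpha> * real k + 1)"
      unfolding eventually_prod_filter
      by (rule exI[of _ "\<lambda>_. True"], rule exI[of _ "\<lambda>n. n > 0"])
        (auto simp: bound[simplified] eventually_gt_at_top)
  qed simp
  then show ?thesis
    by (simp add: a_def ml_approx_def mittag_leffler_def)
qed

lemma mittag_leffler_nonneg_mono:
  assumes \<alpha>: "0 < \<alpha>" "\<alpha> \<le> 1" and xy: "x \<le> y" "y \<le> 0"
  shows "0 \<le> mittag_leffler \<alpha> 1 x" and "mittag_leffler \<alpha> 1 x \<le> mittag_leffler \<alpha> 1 y"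
proof -
  have approx: "0 \<le> ml_approx \<alpha> n (- x * real n powr (1 - \<alpha>)) \<and>
      ml_approx \<alpha> n (- x * real n powr (1 - \<alpha>)) \<le> ml_approx \<alpha> n (- y * real n powr (1 - \<alpha>))" for n
    using \<alpha> xy by (intro ml_approx_nonneg_antimono mult_right_mono) (auto simp: mult_nonpos_nonneg)
  have lim: "(\<lambda>n. ml_approx \<alpha> n (- z * real n powr (1 - \<alpha>))) \<longlonglongrightarrow> mittag_leffler \<alpha> 1 z" for z
    using ml_approx_tendsto[OF \<alpha>, of "- z"] by simp
  show "0 \<le> mittag_leffler \<alpha> 1 x"
    using approx by (intro LIMSEQ_le_const[OF lim]) blast
  show "mittag_leffler \<alpha> 1 x \<le> mittag_leffler \<alpha> 1 y"
    using approx by (intro LIMSEQ_le[OF lim lim]) blast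
qed

lemma mittag_leffler_0: "mittag_leffler \<alpha> 1 0 = 1"
proof -
  have "(\<lambda>k. 0 ^ k / Gamma (\<alpha> * real k + 1)) = (\<lambda>k. if k = 0 then 1 else (0::real))"
    by (auto simp: fun_eq_iff)
  then show ?thesis
    unfolding mittag_leffler_def using sums_single[of 0 "\<lambda>_. 1::real"] 
    by (simp add: sums_iff)
qed

section \<open>The Atangana-Baleanu derivative at an extremum\<close>

text \<open>
  Second mean value theorem for the increasing kernel, whose value at \<open>s = t\<close> is \<open>E(0) = 1\<close>.
\<close>

lemma AB_derivative_mean_value:
  fixes f f' :: "real \<Rightarrow> real"
  assumes t: "0 \<le> t" and \<alpha>: "0 < \<alpha>" "\<alpha> < 1"
    and f': "\<And>s. s \<in> {0..t} \<Longrightarrow> (f has_real_derivative f' s) (at s within {0..t})"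
  obtains c where "c \<in> {0..t}"
    and "AB_derivative \<alpha> f t = 1 / (1 - \<alpha>) *
      (mittag_leffler \<alpha> 1 (- \<alpha> * (t powr \<alpha> / (1 - \<alpha>))) * (f c - f 0) + (f t - f c))"
proof -
  define K where "K = (\<lambda>s. mittag_leffler \<alpha> 1 (- \<alpha> * ((t - s) powr \<alpha> / (1 - \<alpha>))))"
  have ftc: "(f' has_integral (f b - f a)) {a..b}" if "0 \<le> a" "a \<le> b" "b \<le> t" for a b
  proof (rule fundamental_theorem_of_calculus)
    fix s assume "s \<in> {a..b}"
    then show "(f has_vector_derivative f' s) (at s within {a..b})"
      using that f'[of s] 
      by (auto simp: has_real_derivative_iff_has_vector_derivative
          intro: has_vector_derivative_within_subset)
  qed (use that in simp)
  have K_mono: "K r \<le> K s" if "0 \<le> r" "r \<le> s" "s \<le> t" for r s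
  proof -
    have "\<alpha> * ((t - s) powr \<alpha> / (1 - \<alpha>)) \<le> \<alpha> * ((t - r) powr \<alpha> / (1 - \<alpha>))"
      using that \<alpha> by (intro mult_left_mono divide_right_mono powr_mono2) auto
    then show ?thesis
      unfolding K_def using \<alpha> by (intro mittag_leffler_nonneg_mono(2)) auto
  qed
  obtain c where c: "c \<in> {0..t}" and mvt: "((\<lambda>s. K s * f' s) has_integral
      (K 0 * integral {0..c} f' + K t * integral {c..t} f')) {0..t}"
    using second_mean_value_theorem_full[of f' 0 t K, OF has_integral_integrable[OF ftc] t K_mono] t
    by auto
  have "integral {0..t} (\<lambda>s. vector_derivative f (at s within {0..t}) * K s)
      = K 0 * (f c - f 0) + (f t - f c)"
  \<comment> \<open>on the degenerate interval the one-sided derivative is not determined, but nothing is integrated\<close>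
  proof (cases "t = 0")
    case True
    with c show ?thesis by simp
  next
    case False
    have "integral {0..t} (\<lambda>s. vector_derivative f (at s within {0..t}) * K s)
        = integral {0..t} (\<lambda>s. K s * f' s)"
    proof (rule integral_cong)
      fix s assume s: "s \<in> {0..t}"
      have "vector_derivative f (at s within {0..t}) = f' s"
        using False t s f'[OF s]
        by (intro vector_derivative_within_closed_interval)
          (auto simp: has_real_derivative_iff_has_vector_derivative)
      then show "vector_derivative f (at s within {0..t}) * K s = K s * f' s" by simp
    qed
    also have "\<dots> = K 0 * (f c - f 0) + K t * (f t - f c)"
      using integral_unique[OF mvt] integral_unique[OF ftc[of 0 c]] integral_unique[OF ftc[of c t]] c
      by simp
    also have "K t = 1" using \<alpha> by (simp add: K_def mittag_leffler_0)
    finally show ?thesis by simp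
  qed
  then have "AB_derivative \<alpha> f t = 1 / (1 - \<alpha>) * (K 0 * (f c - f 0) + (f t - f c))"
    by (simp add: AB_derivative_def K_def)
  with c show ?thesis by (intro that) (simp_all only: K_def diff_zero)
qed

text \<open>
  Both parts read off the sign of \<open>(1 - E) (f(t) - f(c))\<close>, the gap between derivative and bound
  up to the factor \<open>1 / (1 - \<alpha>)\<close>, where \<open>0 \<le> E \<le> 1\<close> is the kernel at the lower end point.
\<close>

lemma AB_derivative_at_extremum:
  fixes f f' :: "real \<Rightarrow> real"
  assumes t: "0 \<le> t" and \<alpha>: "0 < \<alpha>" "\<alpha> < 1"
    and f': "\<And>s. s \<in> {0..t} \<Longrightarrow> (f has_real_derivative f' s) (at s within {0..t})"
  defines "B \<equiv> 1 / (1 - \<alpha>) * mittag_leffler \<alpha> 1 (- \<alpha> * (t powr \<alpha> / (1 - \<alpha>))) * (f t - f 0)"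
  shows "(\<And>s. s \<in> {0..t} \<Longrightarrow> f s \<le> f t) \<Longrightarrow> B \<le> AB_derivative \<alpha> f t \<and> 0 \<le> B"
    and "(\<And>s. s \<in> {0..t} \<Longrightarrow> f t \<le> f s) \<Longrightarrow> AB_derivative \<alpha> f t \<le> B \<and> B \<le> 0"
proof -
  define E where "E = mittag_leffler \<alpha> 1 (- \<alpha> * (t powr \<alpha> / (1 - \<alpha>)))"
  have arg: "- \<alpha> * (t powr \<alpha> / (1 - \<alpha>)) \<le> 0" using \<alpha> by simp
  have E: "0 \<le> E" "E \<le> 1"
    using mittag_leffler_nonneg_mono[of \<alpha> _ 0, OF _ _ arg] \<alpha>
    by (simp_all add: E_def mittag_leffler_0)
  obtain c where c: "c \<in> {0..t}"
    and AB: "AB_derivative \<alpha> f t = 1 / (1 - \<alpha>) * (E * (f c - f 0) + (f t - f c))"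
    unfolding E_def using AB_derivative_mean_value[OF t \<alpha> f'] by blast
  have gap: "AB_derivative \<alpha> f t - B = 1 / (1 - \<alpha>) * ((1 - E) * (f t - f c))"
    unfolding AB B_def E_def[symmetric] by (simp only: mult.assoc right_diff_distrib[symmetric])
      (simp add: algebra_simps)
  have B: "B = 1 / (1 - \<alpha>) * E * (f t - f 0)" by (simp add: B_def E_def)
  {
    assume max: "\<And>s. s \<in> {0..t} \<Longrightarrow> f s \<le> f t"
    have "0 \<le> AB_derivative \<alpha> f t - B"
      unfolding gap using max[OF c] E \<alpha> by (intro mult_nonneg_nonneg) auto
    moreover have "0 \<le> B"
      unfolding B using max[of 0] t E \<alpha> by (intro mult_nonneg_nonneg) auto
    ultimately show "B \<le> AB_derivative \<alpha> f t \<and> 0 \<le> B" by simp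
  next
    assume min: "\<And>s. s \<in> {0..t} \<Longrightarrow> f t \<le> f s"
    have "AB_derivative \<alpha> f t - B \<le> 0"
      unfolding gap using min[OF c] E \<alpha> by (intro mult_nonneg_nonpos) auto
    moreover have "B \<le> 0"
      unfolding B using min[of 0] t E \<alpha> by (intro mult_nonneg_nonpos) auto
    ultimately show "AB_derivative \<alpha> f t \<le> B \<and> B \<le> 0" by simp
  }
qed

theorem lemma2p2:
  fixes T :: real and f f' :: "real \<Rightarrow> real"
  assumes "T > 0"
    and "\<And>t. t \<in> {0..T} \<Longrightarrow> (f has_real_derivative f' t) (at t within {0..T})"
    and "continuous_on {0..T} f'"
  shows "(\<forall>t0\<in>{0..T}. (\<forall>t\<in>{0..T}. f t \<le> f t0) \<longrightarrow>
           (\<forall>\<alpha>::real. 0 < \<alpha> \<and> \<alpha> < 1 \<longrightarrow>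
              AB_derivative \<alpha> f t0
                \<ge> 1 / (1 - \<alpha>) * mittag_leffler \<alpha> 1 (- \<alpha> * (t0 powr \<alpha> / (1 - \<alpha>))) * (f t0 - f 0)
            \<and> 1 / (1 - \<alpha>) * mittag_leffler \<alpha> 1 (- \<alpha> * (t0 powr \<alpha> / (1 - \<alpha>))) * (f t0 - f 0)
                \<ge> 0))
       \<and> (\<forall>t0\<in>{0..T}. (\<forall>t\<in>{0..T}. f t0 \<le> f t) \<longrightarrow>
           (\<forall>\<alpha>::real. 0 < \<alpha> \<and> \<alpha> < 1 \<longrightarrow>
              AB_derivative \<alpha> f t0
                \<le> 1 / (1 - \<alpha>) * mittag_leffler \<alpha> 1 (- \<alpha> * (t0 powr \<alpha> / (1 - \<alpha>))) * (f t0 - f 0)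
            \<and> 1 / (1 - \<alpha>) * mittag_leffler \<alpha> 1 (- \<alpha> * (t0 powr \<alpha> / (1 - \<alpha>))) * (f t0 - f 0)
                \<le> 0))"
proof -
  have f': "(f has_real_derivative f' s) (at s within {0..t})"
    if "t \<in> {0..T}" "s \<in> {0..t}" for s t
    using assms(2)[of s] that by (auto intro: DERIV_subset)
  show ?thesis
  proof (intro conjI ballI impI allI; elim conjE)
    fix t0 \<alpha> :: real
    assume t0: "t0 \<in> {0..T}" and \<alpha>: "0 < \<alpha>" "\<alpha> < 1"
    from t0 have t0': "0 \<le> t0" and sub: "\<And>s. s \<in> {0..t0} \<Longrightarrow> s \<in> {0..T}" by auto
    note extremum = AB_derivative_at_extremum[OF t0' \<alpha> f'[OF t0]]
    {
      assume "\<forall>t\<in>{0..T}. f t \<le> f t0"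
      with sub have "\<And>s. s \<in> {0..t0} \<Longrightarrow> f s \<le> f t0" by blast
      note max = extremum(1)[OF _ this]
      from max show "1 / (1 - \<alpha>) * mittag_leffler \<alpha> 1 (- \<alpha> * (t0 powr \<alpha> / (1 - \<alpha>))) * (f t0 - f 0)
          \<le> AB_derivative \<alpha> f t0" by blast
      from max show "0 \<le> 1 / (1 - \<alpha>) * mittag_leffler \<alpha> 1 (- \<alpha> * (t0 powr \<alpha> / (1 - \<alpha>))) *
          (f t0 - f 0)" by blast
    next
      assume "\<forall>t\<in>{0..T}. f t0 \<le> f t"
      with sub have "\<And>s. s \<in> {0..t0} \<Longrightarrow> f t0 \<le> f s" by blast
      note min = extremum(2)[OF _ this]
      from min show "AB_derivative \<alpha> f t0
          \<le> 1 / (1 - \<alpha>) * mittag_leffler \<alpha> 1 (- \<alpha> * (t0 powr \<alpha> / (1 - \<alpha>))) * (f t0 - f 0)" by blast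
      from min show "1 / (1 - \<alpha>) * mittag_leffler \<alpha> 1 (- \<alpha> * (t0 powr \<alpha> / (1 - \<alpha>))) *
          (f t0 - f 0) \<le> 0" by blast
    }
  qed
qed

end
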